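(* Let $E$ be either $C_b(X)$, where $X$ is a locally compact metric space, or $L^p(X)$, for some $p\in[1,\infty]$ and some $\sigma$-finite measure space $X$. Let $A$ be a closed linear operator on $E$ and let $(\lambda,\varphi)$ be an eigenpair of $A$. Let $\rho$ be a positive function in $E$ such that $\frac{\varphi}{\rho}$ is bounded (resp. essentially bounded). Then the following assertions hold, where inequalities hold for all $x\in X$ in the case $E=C_b(X)$ and for a.e. $x\in X$ in the case $E=L^p(X)$. (1) If $A$ has positive inverse, then \[ |\varphi(x)|\le|\lambda|\left\|\frac{\varphi}{\rho}\right\|_\infty A^{-1}\rho(x). \] (2) If $-A$ generates a positive semigroup, then \[ |\varphi(x)|\le\left\|\frac{\varphi}{\rho}\right\|_\infty e^{t\operatorname{Re}\lambda}\,e^{-tA}\rho(x)\qquad\text{for all }t\ge0 . \] (3) If $A$ has a positive inverse and $-A$ generates a positive semigroup, then \[ |\varphi(x)|\le|\lambda|\left\|\frac{\varphi}{\rho}\right\|_\infty e^{t\operatorname{Re}\lambda}\,e^{-tA}A^{-1}\rho(x)\qquad\text{for all }t\ge0 . \]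
   Context: Positivity of operators is meant in the sense of Banach lattices: a bounded operator $B$ on $E$ is positive if $Bf\ge0$ whenever $f\ge0$; "$A$ has positive inverse" means that $A:D(A)\to E$ is bijective with $A^{-1}$ a positive bounded operator on $E$; a semigroup $(e^{-tA})_{t\ge0}$ is positive if each $e^{-tA}$ is positive. An eigenpair means $0\neq\varphi\in D(A)$ with $A\varphi=\lambda\varphi$, $\lambda\in\mathbb C$. "Positive function" means $\rho(x)>0$ for all (resp. a.e.) $x$. *)

theory Defs
  imports "HOL-Analysis.Analysis" "HOL-Library.Complex_Order"
begin

text \<open>
  The spaces \<open>C\<^sub>b(X)\<close> and \<open>L\<^sup>p(X)\<close> are presented by complex-valued functions together with a
  filter \<open>ae\<close>.  Two functions denote the same vector iff they agree eventually along \<open>ae\<close>: for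
  \<open>C\<^sub>b(X)\<close> this means everywhere on \<open>X\<close> (HOL functions are total, their values off the carrier
  of \<open>X\<close> are irrelevant), for \<open>L\<^sup>p(X)\<close> it means almost everywhere.  So every equation and
  inequality between vectors below is an eventual one.  Inequalities use the order on
  \<^typ>\<open>complex\<close> of \<^theory>\<open>HOL-Library.Complex_Order\<close>, where \<open>z \<le> w\<close> says that \<open>w - z\<close> is
  a nonnegative real number; in particular \<open>0 < z\<close> says that \<open>z\<close> is real and positive.
\<close>

record 'a fspace =
  Fun :: "('a \<Rightarrow> complex) set"
  ae :: "'a filter"
  nrm :: "('a \<Rightarrow> complex) \<Rightarrow> real"

text \<open>Supremum norm along \<open>principal (topspace X)\<close>, essential supremum along \<open>ae_filter M\<close>.
  Since \<open>Inf {}\<close> is unspecified, this is meaningful only together with \<open>ess_bdd\<close>.\<close>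

definition ess_bdd :: "'a filter \<Rightarrow> ('a \<Rightarrow> complex) \<Rightarrow> bool"
  where "ess_bdd F f \<longleftrightarrow> (\<exists>c. \<forall>\<^sub>F x in F. cmod (f x) \<le> c)"

definition supnorm :: "'a filter \<Rightarrow> ('a \<Rightarrow> complex) \<Rightarrow> real"
  where "supnorm F f = Inf {c. 0 \<le> c \<and> (\<forall>\<^sub>F x in F. cmod (f x) \<le> c)}"

lemma supnorm_principal:
  assumes "S \<noteq> {}" "bdd_above ((\<lambda>x. cmod (f x)) ` S)"
  shows "supnorm (principal S) f = (SUP x\<in>S. cmod (f x))"
proof -
  obtain a where a: "a \<in> S" using assms(1) by blast
  have "0 \<le> cmod (f a)" by simp
  also have "\<dots> \<le> (SUP x\<in>S. cmod (f x))" using assms(2) a by (rule cSUP_upper2) simp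
  finally have nn: "0 \<le> (SUP x\<in>S. cmod (f x))" .
  show ?thesis
    unfolding supnorm_def eventually_principal
  proof (rule cInf_eq_minimum)
    show "(SUP x\<in>S. cmod (f x)) \<in> {c. 0 \<le> c \<and> (\<forall>x\<in>S. cmod (f x) \<le> c)}"
      using nn assms(2) by (auto intro: cSUP_upper)
  next
    fix c assume "c \<in> {c. 0 \<le> c \<and> (\<forall>x\<in>S. cmod (f x) \<le> c)}"
    then show "(SUP x\<in>S. cmod (f x)) \<le> c" using assms(1) by (auto intro: cSUP_least)
  qed
qed

definition Cb_space :: "'a topology \<Rightarrow> 'a fspace"
  where "Cb_space X =
    \<lparr> Fun = {f. continuous_map X euclidean f \<and> bounded (f ` topspace X)},
      ae = principal (topspace X),
      nrm = supnorm (principal (topspace X)) \<rparr>"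

definition Lp_space :: "ennreal \<Rightarrow> 'a measure \<Rightarrow> 'a fspace"
  where "Lp_space p M =
    \<lparr> Fun = {f \<in> borel_measurable M.
        if p = \<infinity> then ess_bdd (ae_filter M) f
        else integrable M (\<lambda>x. cmod (f x) powr enn2real p)},
      ae = ae_filter M,
      nrm = (\<lambda>f. if p = \<infinity> then supnorm (ae_filter M) f
        else (\<integral>x. cmod (f x) powr enn2real p \<partial>M) powr (1 / enn2real p)) \<rparr>"

definition Cb_or_Lp :: "'a fspace \<Rightarrow> bool"
  where "Cb_or_Lp E \<longleftrightarrow>
    (\<exists>m :: 'a metric. locally_compact_space (mtopology_of m) \<and> E = Cb_space (mtopology_of m)) \<or>
    (\<exists>(M :: 'a measure) p. sigma_finite_measure M \<and> 1 \<le> p \<and> E = Lp_space p M)"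

definition eqv :: "'a fspace \<Rightarrow> ('a \<Rightarrow> complex) \<Rightarrow> ('a \<Rightarrow> complex) \<Rightarrow> bool"
  where "eqv E f g \<longleftrightarrow> (\<forall>\<^sub>F x in ae E. f x = g x)"

text \<open>An operator is a map \<open>A\<close> on representatives with domain \<open>D\<close>; the second and third
  conditions say that \<open>D\<close> and \<open>A\<close> descend to vectors.\<close>

definition linear_op ::
  "'a fspace \<Rightarrow> ('a \<Rightarrow> complex) set \<Rightarrow> (('a \<Rightarrow> complex) \<Rightarrow> 'a \<Rightarrow> complex) \<Rightarrow> bool"
  where "linear_op E D A \<longleftrightarrow>
    D \<subseteq> Fun E \<and>
    (\<forall>f\<in>D. \<forall>g\<in>Fun E. eqv E f g \<longrightarrow> g \<in> D) \<and>
    (\<forall>f\<in>D. \<forall>g\<in>D. eqv E f g \<longrightarrow> eqv E (A f) (A g)) \<and>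
    (\<forall>f\<in>D. A f \<in> Fun E) \<and>
    (\<lambda>x. 0) \<in> D \<and>
    (\<forall>f\<in>D. \<forall>g\<in>D. (\<lambda>x. f x + g x) \<in> D \<and> eqv E (A (\<lambda>x. f x + g x)) (\<lambda>x. A f x + A g x)) \<and>
    (\<forall>c. \<forall>f\<in>D. (\<lambda>x. c * f x) \<in> D \<and> eqv E (A (\<lambda>x. c * f x)) (\<lambda>x. c * A f x))"

definition closed_op ::
  "'a fspace \<Rightarrow> ('a \<Rightarrow> complex) set \<Rightarrow> (('a \<Rightarrow> complex) \<Rightarrow> 'a \<Rightarrow> complex) \<Rightarrow> bool"
  where "closed_op E D A \<longleftrightarrow>
    linear_op E D A \<and>
    (\<forall>u f g. (\<forall>n::nat. u n \<in> D) \<and> f \<in> Fun E \<and> g \<in> Fun E \<and>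
       (\<lambda>n. nrm E (\<lambda>x. u n x - f x)) \<longlonglongrightarrow> 0 \<and>
       (\<lambda>n. nrm E (\<lambda>x. A (u n) x - g x)) \<longlonglongrightarrow> 0 \<longrightarrow>
       f \<in> D \<and> eqv E (A f) g)"

definition bounded_op :: "'a fspace \<Rightarrow> (('a \<Rightarrow> complex) \<Rightarrow> 'a \<Rightarrow> complex) \<Rightarrow> bool"
  where "bounded_op E B \<longleftrightarrow>
    linear_op E (Fun E) B \<and> (\<exists>C. \<forall>f\<in>Fun E. nrm E (B f) \<le> C * nrm E f)"

definition positive_op :: "'a fspace \<Rightarrow> (('a \<Rightarrow> complex) \<Rightarrow> 'a \<Rightarrow> complex) \<Rightarrow> bool"
  where "positive_op E B \<longleftrightarrow>
    bounded_op E B \<and>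
    (\<forall>f\<in>Fun E. (\<forall>\<^sub>F x in ae E. 0 \<le> f x) \<longrightarrow> (\<forall>\<^sub>F x in ae E. 0 \<le> B f x))"

definition eigenpair ::
  "'a fspace \<Rightarrow> ('a \<Rightarrow> complex) set \<Rightarrow> (('a \<Rightarrow> complex) \<Rightarrow> 'a \<Rightarrow> complex) \<Rightarrow>
    complex \<Rightarrow> ('a \<Rightarrow> complex) \<Rightarrow> bool"
  where "eigenpair E D A \<mu> \<phi> \<longleftrightarrow>
    \<phi> \<in> D \<and> \<not> eqv E \<phi> (\<lambda>x. 0) \<and> eqv E (A \<phi>) (\<lambda>x. \<mu> * \<phi> x)"

definition bijective_op ::
  "'a fspace \<Rightarrow> ('a \<Rightarrow> complex) set \<Rightarrow> (('a \<Rightarrow> complex) \<Rightarrow> 'a \<Rightarrow> complex) \<Rightarrow> bool"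
  where "bijective_op E D A \<longleftrightarrow>
    (\<forall>f\<in>D. \<forall>g\<in>D. eqv E (A f) (A g) \<longrightarrow> eqv E f g) \<and>
    (\<forall>g\<in>Fun E. \<exists>f\<in>D. eqv E (A f) g)"

text \<open>\<open>A : D \<rightarrow> E\<close> is bijective and its inverse \<open>B\<close> is a positive bounded operator.\<close>

definition has_positive_inverse ::
  "'a fspace \<Rightarrow> ('a \<Rightarrow> complex) set \<Rightarrow> (('a \<Rightarrow> complex) \<Rightarrow> 'a \<Rightarrow> complex) \<Rightarrow>
    (('a \<Rightarrow> complex) \<Rightarrow> 'a \<Rightarrow> complex) \<Rightarrow> bool"
  where "has_positive_inverse E D A B \<longleftrightarrow>
    bijective_op E D A \<and>
    (\<forall>g\<in>Fun E. B g \<in> D \<and> eqv E (A (B g)) g) \<and>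
    positive_op E B"

definition C0_semigroup :: "'a fspace \<Rightarrow> (real \<Rightarrow> ('a \<Rightarrow> complex) \<Rightarrow> 'a \<Rightarrow> complex) \<Rightarrow> bool"
  where "C0_semigroup E T \<longleftrightarrow>
    (\<forall>t\<ge>0. bounded_op E (T t)) \<and>
    (\<forall>f\<in>Fun E. eqv E (T 0 f) f) \<and>
    (\<forall>s\<ge>0. \<forall>t\<ge>0. \<forall>f\<in>Fun E. eqv E (T (s + t) f) (T s (T t f))) \<and>
    (\<forall>f\<in>Fun E. ((\<lambda>t. nrm E (\<lambda>x. T t f x - f x)) \<longlongrightarrow> 0) (at_right 0))"

text \<open>The operator \<open>G\<close> with domain \<open>D\<close> is the infinitesimal generator of \<open>T\<close>: its graph
  consists of the pairs \<open>(f, g)\<close> such that \<open>(T h f - f) / h\<close> converges to \<open>g\<close> in norm.\<close>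

definition generates ::
  "'a fspace \<Rightarrow> ('a \<Rightarrow> complex) set \<Rightarrow> (('a \<Rightarrow> complex) \<Rightarrow> 'a \<Rightarrow> complex) \<Rightarrow>
    (real \<Rightarrow> ('a \<Rightarrow> complex) \<Rightarrow> 'a \<Rightarrow> complex) \<Rightarrow> bool"
  where "generates E D G T \<longleftrightarrow>
    C0_semigroup E T \<and> linear_op E D G \<and>
    (\<forall>f\<in>Fun E. \<forall>g\<in>Fun E.
       (f \<in> D \<and> eqv E (G f) g) \<longleftrightarrow>
       ((\<lambda>h. nrm E (\<lambda>x. (T h f x - f x) / of_real h - g x)) \<longlongrightarrow> 0) (at_right 0))"

definition generates_positive_semigroup ::
  "'a fspace \<Rightarrow> ('a \<Rightarrow> complex) set \<Rightarrow> (('a \<Rightarrow> complex) \<Rightarrow> 'a \<Rightarrow> complex) \<Rightarrow>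
    (real \<Rightarrow> ('a \<Rightarrow> complex) \<Rightarrow> 'a \<Rightarrow> complex) \<Rightarrow> bool"
  where "generates_positive_semigroup E D G T \<longleftrightarrow>
    generates E D G T \<and> (\<forall>t\<ge>0. positive_op E (T t))"

end

theory Submission
  imports Defs
begin

text \<open>
  We have \<open>\<bar>\<phi>\<bar> \<le> \<parallel>\<phi>/\<rho>\<parallel>\<^sub>\<infinity> \<rho>\<close>, and a positive operator \<open>B\<close> preserves domination:
  \<open>\<bar>f\<bar> \<le> g\<close> implies \<open>\<bar>B f\<bar> \<le> B g\<close>.  So everything follows from the eigenvalue equations
  \<open>\<phi> = \<lambda> A\<^sup>-\<^sup>1 \<phi>\<close> and \<open>\<phi> = e\<^sup>\<lambda>\<^sup>t e\<^sup>-\<^sup>t\<^sup>A \<phi>\<close>.  The second one says that the orbit of \<open>\<phi>\<close> under the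
  rescaled semigroup, whose right derivative vanishes, is constant.
\<close>

section \<open>Fixed points of semigroups of Lipschitz maps\<close>

text \<open>Applying the bounded operator at time s to the limits at time 0 shows that the orbit is
  continuous from the right at every s, with right derivative 0. This alone does not make it
  constant, as a step function that is continuous from the right shows. What excludes jumps is a
  bound on the operators that is uniform over an interval of times: a piece of that interval, cut
  into m equal steps, then costs m times o(1/m). To find such an interval, the times are classified
  by the size of the Lipschitz constant. For (3), the bound of (1) serves as the domination to which
  the semigroup is applied, with the image of \<rho> under the inverse as the new majorant.\<close>

lemma Baire_real:
  fixes F :: "nat \<Rightarrow> real set" and l u :: real
  assumes "l < u" "{l<..<u} \<subseteq> (\<Union>n. F n)"
  obtains n a b where "l < a" "a < b" "b < u" "{a..b} \<subseteq> closure (F n)"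
proof -
  have "\<exists>n. {l<..<u} \<inter> interior (closure (F n)) \<noteq> {}"
  proof (rule ccontr)
    assume neg: "\<nexists>n. {l<..<u} \<inter> interior (closure (F n)) \<noteq> {}"
    \<comment> \<open>The negated claim restricts \<open>F n\<close> only inside the interval;
      elsewhere \<open>F n\<close> may be dense. Cutting it down to \<open>{l<..<u}\<close> makes
      each \<open>H n\<close> open and dense in the whole line, so that \<open>Baire\<close> applies
      to \<open>UNIV\<close>.\<close>
    define H where "H n = - (closure ({l<..<u} \<inter> F n))" for n
    have sub: "interior (closure ({l<..<u} \<inter> F n)) = {}" for n
    proof (rule ccontr)
      let ?U = "interior (closure ({l<..<u} \<inter> F n))"
      assume "?U \<noteq> {}"
      moreover have "?U \<subseteq> closure {l<..<u}"
        by (meson closure_mono inf_le1 interior_subset order_trans)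
      ultimately have "?U \<inter> {l<..<u} \<noteq> {}"
        by (metis open_Int_closure_eq_empty open_interior inf.absorb_iff1)
      moreover have "?U \<subseteq> interior (closure (F n))"
        by (intro interior_mono closure_mono) auto
      ultimately show False using neg by blast
    qed
    have "UNIV \<subseteq> closure (\<Inter>(range H))"
    proof (rule Baire)
      fix T assume "T \<in> range H"
      then obtain n where T: "T = H n" by auto
      show "openin (top_of_set UNIV) T \<and> UNIV \<subseteq> closure T"
        unfolding T H_def by (simp add: closure_complement sub open_Compl)
    qed auto
    then have "\<Inter>(range H) \<inter> {l<..<u} \<noteq> {}"
      using \<open>l < u\<close> open_Int_closure_eq_empty[of "{l<..<u}" "\<Inter>(range H)"]
      by (auto simp: Int_commute top.extremum_unique)
    then obtain x where "x \<in> {l<..<u}" "\<And>n. x \<in> H n" by blast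
    moreover have "{l<..<u} \<inter> F n \<subseteq> - H n" for n
      unfolding H_def by (simp add: closure_subset)
    ultimately show False using assms(2) by blast
  qed
  then obtain n x where x: "x \<in> {l<..<u} \<inter> interior (closure (F n))" by blast
  moreover have "open ({l<..<u} \<inter> interior (closure (F n)))"
    by (intro open_Int open_greaterThanLessThan open_interior)
  ultimately obtain e where e: "e > 0" "cball x e \<subseteq> {l<..<u} \<inter> interior (closure (F n))"
    using open_contains_cball by metis
  have "x - e \<in> cball x e" "x + e \<in> cball x e" using e(1) by (auto simp: dist_real_def)
  then have "x - e \<in> {l<..<u}" "x + e \<in> {l<..<u}" using e(2) by blast+
  moreover have "{x - e..x + e} \<subseteq> closure (F n)"
    using e(2) interior_subset by (auto simp: cball_eq_atLeastAtMost)
  ultimately show thesis using that[of "x - e" "x + e" n] e(1) by auto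
qed

text \<open>Baire's theorem on the real line replaces the uniform boundedness principle on \<open>V\<close>: any
  interval to the right of 0 contains a subinterval on which the maps have a common Lipschitz
  constant.  There the orbit of \<open>p\<close> is constant by telescoping, hence it is constant from that
  point onwards.\<close>

lemma lipschitz_semigroup_fixpoint:
  fixes d :: "'b \<Rightarrow> 'b \<Rightarrow> real" and S :: "real \<Rightarrow> 'b \<Rightarrow> 'b"
  assumes refl: "\<And>f. f \<in> V \<Longrightarrow> d f f = 0"
    and nonneg: "\<And>f g. f \<in> V \<Longrightarrow> g \<in> V \<Longrightarrow> 0 \<le> d f g"
    and sym: "\<And>f g. f \<in> V \<Longrightarrow> g \<in> V \<Longrightarrow> d f g = d g f"
    and tri: "\<And>f g h. f \<in> V \<Longrightarrow> g \<in> V \<Longrightarrow> h \<in> V \<Longrightarrow> d f h \<le> d f g + d g h"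
    and mem: "\<And>t f. 0 \<le> t \<Longrightarrow> f \<in> V \<Longrightarrow> S t f \<in> V"
    and lip: "\<And>t. 0 \<le> t \<Longrightarrow> \<exists>C. \<forall>f\<in>V. \<forall>g\<in>V. d (S t f) (S t g) \<le> C * d f g"
    and semi: "\<And>s t f. 0 \<le> s \<Longrightarrow> 0 \<le> t \<Longrightarrow> f \<in> V \<Longrightarrow> d (S (s + t) f) (S s (S t f)) = 0"
    and cont: "\<And>f. f \<in> V \<Longrightarrow> ((\<lambda>h. d (S h f) f) \<longlongrightarrow> 0) (at_right 0)"
    and p: "p \<in> V"
    and deriv: "((\<lambda>h. d (S h p) p / h) \<longlongrightarrow> 0) (at_right 0)"
    and t: "0 < t"
  shows "d (S t p) p = 0"
proof -
  define K where "K n = {s. 0 \<le> s \<and> (\<forall>f\<in>V. \<forall>g\<in>V. d (S s f) (S s g) \<le> real n * d f g)}" for n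
  have step: "d (S (s + h) f) (S s f) \<le> C * d (S h f) f"
    if "0 \<le> s" "0 \<le> h" "f \<in> V" "\<forall>f\<in>V. \<forall>g\<in>V. d (S s f) (S s g) \<le> C * d f g" for s h f C
  proof -
    have "d (S (s + h) f) (S s f) \<le> d (S (s + h) f) (S s (S h f)) + d (S s (S h f)) (S s f)"
      using that by (intro tri mem) auto
    also have "\<dots> \<le> 0 + C * d (S h f) f" using that semi mem by (intro add_mono) auto
    finally show ?thesis by simp
  qed
  have rcont: "((\<lambda>h. d (S (s + h) f) (S s f)) \<longlongrightarrow> 0) (at_right 0)" if s: "0 \<le> s" and f: "f \<in> V" for s f
  proof -
    obtain C where C: "\<forall>f\<in>V. \<forall>g\<in>V. d (S s f) (S s g) \<le> C * d f g" using lip s by blast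
    have le: "\<forall>\<^sub>F h in at_right 0. d (S (s + h) f) (S s f) \<le> C * d (S h f) f"
      using eventually_at_right_less by (rule eventually_mono) (use step C s f in auto)
    have ge: "\<forall>\<^sub>F h in at_right 0. 0 \<le> d (S (s + h) f) (S s f)"
      using eventually_at_right_less by (rule eventually_mono) (use nonneg mem s f in auto)
    have "((\<lambda>h. C * d (S h f) f) \<longlongrightarrow> 0) (at_right 0)"
      using tendsto_mult_right_zero[OF cont[OF f]] .
    then show ?thesis by (rule tendsto_sandwich[OF ge le tendsto_const])
  qed
  \<comment> \<open>Orbits are known to be continuous only from the right, so \<open>K n\<close> is
    shown to contain the limits of its points from above, not to be closed. For r slightly larger
    than s, \<open>S r\<close> is close to \<open>S s\<close> at both f and g, and the Lipschitz
    estimate passes from r to s up to e.\<close>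
  have closed: "s \<in> K n" if s: "0 \<le> s" and acc: "\<And>e. 0 < e \<Longrightarrow> \<exists>r\<in>K n. s < r \<and> r < s + e" for s n
  proof -
    have "d (S s f) (S s g) \<le> real n * d f g" if f: "f \<in> V" and g: "g \<in> V" for f g
    proof (rule field_le_epsilon)
      fix e :: real assume e: "0 < e"
      have "\<forall>\<^sub>F h in at_right 0. d (S (s + h) f) (S s f) < e/2 \<and> d (S (s + h) g) (S s g) < e/2"
        using order_tendstoD(2)[OF rcont[OF s f], of "e/2"] order_tendstoD(2)[OF rcont[OF s g], of "e/2"] e
        by (auto intro: eventually_conj)
      then obtain b where b: "b > 0"
        "\<And>h. 0 < h \<Longrightarrow> h < b \<Longrightarrow> d (S (s + h) f) (S s f) < e/2 \<and> d (S (s + h) g) (S s g) < e/2"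
        unfolding eventually_at_right_field by auto
      obtain r where r: "r \<in> K n" "s < r" "r < s + b" using acc[OF b(1)] by blast
      have c: "d (S r f) (S s f) < e/2" "d (S r g) (S s g) < e/2"
        using b(2)[of "r - s"] r by auto
      have V: "S r f \<in> V" "S r g \<in> V" "S s f \<in> V" "S s g \<in> V" using mem s r f g by auto
      have "d (S s f) (S s g) \<le> d (S s f) (S r f) + (d (S r f) (S r g) + d (S r g) (S s g))"
        using tri[of "S s f" "S r f" "S s g"] tri[of "S r f" "S r g" "S s g"] V by fastforce
      moreover have "d (S r f) (S r g) \<le> real n * d f g" using r f g by (auto simp: K_def)
      ultimately show "d (S s f) (S s g) \<le> real n * d f g + e"
        using c V sym[of "S s f" "S r f"] by auto
    qed
    with s show ?thesis by (simp add: K_def)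
  qed
  have cover: "s \<in> (\<Union>n. K n)" if s: "0 \<le> s" for s
  proof -
    obtain C where C: "\<forall>f\<in>V. \<forall>g\<in>V. d (S s f) (S s g) \<le> C * d f g" using lip s by blast
    obtain n where n: "C \<le> real n" using real_arch_simple by blast
    have "s \<in> K n"
      using s C mult_right_mono[OF n nonneg] by (force simp: K_def)
    then show ?thesis by blast
  qed
  have const: "d (S t p) (S a p) = 0" if ab: "0 < a" "a < b" "a < t" "{a..<b} \<subseteq> K n" for a b n
  proof -
    have loc: "d (S (a + s) p) (S a p) = 0" if s: "0 < s" "a + s < b" for s
    proof -
      have tele: "d (S (a + real k * h) p) (S a p) \<le> real k * (real n * d (S h p) p)"
        if "0 < h" "a + real k * h < b" for k h
        using that
      proof (induction k)
        case 0
        then show ?case using refl mem p ab by simp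
      next
        case (Suc k)
        have lt: "a + real k * h < b" using Suc.prems by (simp add: algebra_simps)
        have nn: "0 \<le> real k * h" using Suc.prems by simp
        have in_K: "a + real k * h \<in> K n" using lt nn ab by auto
        have "d (S (a + real k * h + h) p) (S (a + real k * h) p) \<le> real n * d (S h p) p"
          using in_K Suc.prems(1) p by (intro step) (auto simp: K_def)
        moreover have "d (S (a + real k * h + h) p) (S a p) \<le>
            d (S (a + real k * h + h) p) (S (a + real k * h) p) + d (S (a + real k * h) p) (S a p)"
          using ab Suc.prems nn p by (intro tri mem) auto
        ultimately show ?case using Suc.IH[OF Suc.prems(1) lt] by (simp add: algebra_simps)
      qed
      \<comment> \<open>With h = s / (m + 1), the m + 1 steps of length h cost (m + 1) n
        \<open>d (S h p) p\<close>, which is s n times the difference quotient at h. All starting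
        points a + k h of the steps lie in \<open>{a..<b}\<close>, hence in
        \<open>K n\<close>.\<close>
      have bound: "d (S (a + s) p) (S a p) \<le> s * real n * (d (S (s / real (Suc m)) p) p / (s / real (Suc m)))" for m
        using tele[of "s / real (Suc m)" "Suc m"] s by (simp add: field_simps del: of_nat_Suc)
      have "filterlim (\<lambda>m. s / real (Suc m)) (at_right 0) sequentially"
        using s LIMSEQ_Suc[OF lim_const_over_n[of s]]
        by (auto simp: filterlim_at eventually_sequentially simp del: of_nat_Suc)
      then have "(\<lambda>m. d (S (s / real (Suc m)) p) p / (s / real (Suc m))) \<longlonglongrightarrow> 0"
        by (rule filterlim_compose[OF deriv])
      then have "(\<lambda>m. s * real n * (d (S (s / real (Suc m)) p) p / (s / real (Suc m)))) \<longlonglongrightarrow> 0"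
        by (rule tendsto_mult_right_zero)
      then have "d (S (a + s) p) (S a p) \<le> 0"
        using bound by (intro LIMSEQ_le_const) auto
      then show ?thesis using nonneg mem p ab s by (intro antisym) auto
    qed
    \<comment> \<open>\<open>S (r - a)\<close> carries the local identity at a to any later time r.
      Its Lipschitz constant may be arbitrarily large, since it multiplies a distance 0; hence r is
      no longer confined to the interval.\<close>
    have shift: "d (S (r + s) p) (S r p) = 0" if r: "a \<le> r" and s: "0 < s" "a + s < b" for r s
    proof -
      obtain C where C: "\<forall>f\<in>V. \<forall>g\<in>V. d (S (r - a) f) (S (r - a) g) \<le> C * d f g" using lip r by force
      have V: "S (a + s) p \<in> V" "S a p \<in> V" "S (r + s) p \<in> V" "S r p \<in> V"
        "S (r - a) (S (a + s) p) \<in> V" "S (r - a) (S a p) \<in> V"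
        using mem p ab r s by auto
      have "d (S (r - a) (S (a + s) p)) (S (r - a) (S a p)) \<le> 0"
        using C loc[OF s] V by force
      moreover have "d (S (r + s) p) (S (r - a) (S (a + s) p)) = 0"
        using semi[of "r - a" "a + s" p] ab r s p by (simp add: algebra_simps)
      moreover have "d (S (r - a) (S a p)) (S r p) = 0"
        using semi[of "r - a" a p] ab r p V sym by simp
      ultimately show ?thesis
        using tri[of "S (r + s) p" "S (r - a) (S (a + s) p)" "S r p"] V
          tri[of "S (r - a) (S (a + s) p)" "S (r - a) (S a p)" "S r p"] nonneg[of "S (r + s) p" "S r p"]
        by fastforce
    qed
    \<comment> \<open>The path from a to t is divided into m steps, each shorter than
      \<open>b - a\<close>, so that \<open>shift\<close> applies to every one.\<close>
    obtain m where m: "(t - a) / (b - a) < real m" using reals_Archimedean2 by blast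
    have m0: "0 < real m" using m ab by (meson divide_pos_pos diff_gt_0_iff_gt less_trans)
    define s where "s = (t - a) / real m"
    have s: "0 < s" "a + s < b" using m m0 ab by (auto simp: s_def field_simps)
    have "d (S (a + real k * s) p) (S a p) = 0" for k
    proof (induction k)
      case 0
      then show ?case using refl mem p ab by simp
    next
      case (Suc k)
      have V: "S (a + real k * s + s) p \<in> V" "S (a + real k * s) p \<in> V" "S a p \<in> V"
        using mem p ab s by auto
      have "d (S (a + real k * s + s) p) (S (a + real k * s) p) = 0"
        using s by (intro shift) auto
      then have "d (S (a + real k * s + s) p) (S a p) = 0"
        using Suc.IH V tri nonneg by (metis add.right_neutral antisym)
      then show ?case by (simp add: algebra_simps)
    qed
    from this[of m] show ?thesis using m0 by (simp add: s_def)
  qed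
  have "d (S t p) p \<le> 0 + e" if e: "0 < e" for e
  proof -
    obtain u where u: "u > 0" "\<And>h. 0 < h \<Longrightarrow> h < u \<Longrightarrow> d (S h p) p < e"
      using order_tendstoD(2)[OF cont[OF p] e] unfolding eventually_at_right_field by auto
    \<comment> \<open>Below u, the point \<open>S a p\<close> is within e of p; below t, the
      interval lies before the target time, as \<open>const\<close> requires.\<close>
    have "0 < min u t" "{0<..<min u t} \<subseteq> (\<Union>n. K n)" using u t cover by auto
    then obtain n a b where ab: "0 < a" "a < b" "b < min u t" "{a..b} \<subseteq> closure (K n)"
      by (rule Baire_real)
    \<comment> \<open>Every s in \<open>{a..<b}\<close> has a small open interval to its right
      inside the closure of \<open>K n\<close>, so points of \<open>K n\<close> approach it from
      above. At b itself this may fail, hence the half-open interval.\<close>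
    have "{a..<b} \<subseteq> K n"
    proof
      fix s assume s: "s \<in> {a..<b}"
      show "s \<in> K n"
      proof (rule closed)
        fix e :: real assume "0 < e"
        then have "{s<..<min (s + e) b} \<noteq> {}" "{s<..<min (s + e) b} \<subseteq> closure (K n)"
          using s ab by auto
        then have "{s<..<min (s + e) b} \<inter> K n \<noteq> {}"
          by (metis open_Int_closure_eq_empty open_greaterThanLessThan inf.absorb_iff1)
        then show "\<exists>r\<in>K n. s < r \<and> r < s + e" by auto
      qed (use s ab in auto)
    qed
    then have "d (S t p) (S a p) = 0" using ab by (intro const) auto
    moreover have "d (S t p) p \<le> d (S t p) (S a p) + d (S a p) p"
      using ab t p by (intro tri mem) auto
    ultimately show ?thesis using u(2)[of a] ab by auto
  qed
  then have "d (S t p) p \<le> 0" by (rule field_le_epsilon)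
  then show ?thesis using nonneg mem p t by (intro antisym) auto
qed

section \<open>The spaces of bounded continuous and of \<open>p\<close>-integrable functions\<close>

text \<open>For \<open>ae_filter M\<close> this is the stability of null sets under countable
  unions. Together with the general rules for filters it lets statements valid everywhere and
  statements valid almost everywhere be handled by one argument.\<close>

definition countably_complete :: "'a filter \<Rightarrow> bool"
  where "countably_complete F \<longleftrightarrow>
    (\<forall>P. (\<forall>n::nat. eventually (P n) F) \<longrightarrow> (\<forall>\<^sub>F x in F. \<forall>n. P n x))"

lemma countably_completeD:
  assumes "countably_complete F" "\<And>n::nat. eventually (P n) F"
  shows "\<forall>\<^sub>F x in F. \<forall>n. P n x"
  using assms unfolding countably_complete_def by blast

lemma countably_complete_principal: "countably_complete (principal S)"
  by (auto simp: countably_complete_def eventually_principal)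

lemma countably_complete_ae_filter: "countably_complete (ae_filter M)"
  by (simp add: countably_complete_def AE_all_countable)

section \<open>The supremum norm along a filter\<close>

lemma supnorm_nonneg:
  assumes "ess_bdd F f"
  shows "0 \<le> supnorm F f"
proof -
  obtain c where "\<forall>\<^sub>F x in F. cmod (f x) \<le> c" using assms by (auto simp: ess_bdd_def)
  then have "\<forall>\<^sub>F x in F. cmod (f x) \<le> max c 0" by (rule eventually_mono) auto
  then have "{c. 0 \<le> c \<and> (\<forall>\<^sub>F x in F. cmod (f x) \<le> c)} \<noteq> {}"
    by (intro ex_in_conv[THEN iffD1] exI[of _ "max c 0"]) simp
  then show ?thesis unfolding supnorm_def by (rule cInf_greatest) auto
qed

lemma supnorm_le:
  assumes "0 \<le> c" "\<forall>\<^sub>F x in F. cmod (f x) \<le> c"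
  shows "supnorm F f \<le> c"
  unfolding supnorm_def using assms by (intro cInf_lower) (auto intro: bdd_belowI[of _ 0])

text \<open>The infimum defining \<open>supnorm\<close> is attained: each
  \<open>supnorm F f + 1 / real (Suc n)\<close> is an eventual bound, and countable completeness
  makes these bounds hold simultaneously.\<close>

lemma eventually_le_supnorm:
  assumes "countably_complete F" "ess_bdd F f"
  shows "\<forall>\<^sub>F x in F. cmod (f x) \<le> supnorm F f"
proof -
  let ?S = "{c. 0 \<le> c \<and> (\<forall>\<^sub>F x in F. cmod (f x) \<le> c)}"
  obtain c where "\<forall>\<^sub>F x in F. cmod (f x) \<le> c" using assms by (auto simp: ess_bdd_def)
  then have "\<forall>\<^sub>F x in F. cmod (f x) \<le> max c 0" by (rule eventually_mono) auto
  then have ne: "?S \<noteq> {}"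
    by (intro ex_in_conv[THEN iffD1] exI[of _ "max c 0"]) simp
  have "\<forall>\<^sub>F x in F. cmod (f x) \<le> supnorm F f + 1 / real (Suc n)" for n
  proof -
    have "Inf ?S < supnorm F f + 1 / real (Suc n)" by (simp add: supnorm_def)
    then obtain c where "c \<in> ?S" "c < supnorm F f + 1 / real (Suc n)"
      by (rule cInf_lessD[OF ne, THEN bexE])
    then show ?thesis by (auto elim: eventually_mono)
  qed
  with assms(1) have "\<forall>\<^sub>F x in F. \<forall>n. cmod (f x) \<le> supnorm F f + 1 / real (Suc n)"
    by (rule countably_completeD)
  then show ?thesis
  proof (rule eventually_mono)
    fix x assume *: "\<forall>n. cmod (f x) \<le> supnorm F f + 1 / real (Suc n)"
    have "(\<lambda>n. supnorm F f + 1 / real (Suc n)) \<longlonglongrightarrow> supnorm F f + 0"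
      by (intro tendsto_intros LIMSEQ_Suc[OF lim_const_over_n])
    then show "cmod (f x) \<le> supnorm F f" using * by (intro LIMSEQ_le_const) auto
  qed
qed

lemma ess_bdd_add:
  assumes "ess_bdd F f" "ess_bdd F g"
  shows "ess_bdd F (\<lambda>x. f x + g x)"
proof -
  obtain c d where "\<forall>\<^sub>F x in F. cmod (f x) \<le> c" "\<forall>\<^sub>F x in F. cmod (g x) \<le> d"
    using assms by (auto simp: ess_bdd_def)
  then have "\<forall>\<^sub>F x in F. cmod (f x + g x) \<le> c + d"
    by eventually_elim (meson add_mono norm_triangle_ineq order_trans)
  then show ?thesis by (auto simp: ess_bdd_def)
qed

lemma ess_bdd_mult:
  assumes "ess_bdd F f"
  shows "ess_bdd F (\<lambda>x. c * f x)"
proof -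
  obtain d where "\<forall>\<^sub>F x in F. cmod (f x) \<le> d" using assms by (auto simp: ess_bdd_def)
  then have "\<forall>\<^sub>F x in F. cmod (c * f x) \<le> cmod c * d"
    by eventually_elim (simp add: norm_mult mult_left_mono)
  then show ?thesis by (auto simp: ess_bdd_def)
qed

lemma ess_bdd_Re:
  assumes "ess_bdd F f"
  shows "ess_bdd F (\<lambda>x. of_real (Re (f x)))"
proof -
  obtain d where "\<forall>\<^sub>F x in F. cmod (f x) \<le> d" using assms by (auto simp: ess_bdd_def)
  then have "\<forall>\<^sub>F x in F. cmod (of_real (Re (f x))) \<le> d"
    by eventually_elim (use abs_Re_le_cmod order_trans in auto)
  then show ?thesis by (auto simp: ess_bdd_def)
qed

lemma supnorm_add:
  assumes "countably_complete F" "ess_bdd F f" "ess_bdd F g"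
  shows "supnorm F (\<lambda>x. f x + g x) \<le> supnorm F f + supnorm F g"
proof (rule supnorm_le)
  show "\<forall>\<^sub>F x in F. cmod (f x + g x) \<le> supnorm F f + supnorm F g"
    using eventually_le_supnorm[OF assms(1,2)] eventually_le_supnorm[OF assms(1,3)]
    by eventually_elim (meson add_mono norm_triangle_ineq order_trans)
qed (use assms supnorm_nonneg in \<open>auto intro: add_nonneg_nonneg\<close>)

lemma supnorm_mult:
  assumes "countably_complete F" "ess_bdd F f"
  shows "supnorm F (\<lambda>x. c * f x) \<le> cmod c * supnorm F f"
proof (rule supnorm_le)
  show "\<forall>\<^sub>F x in F. cmod (c * f x) \<le> cmod c * supnorm F f"
    using eventually_le_supnorm[OF assms] by eventually_elim (simp add: norm_mult mult_left_mono)
qed (intro mult_nonneg_nonneg norm_ge_zero supnorm_nonneg assms)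

lemma supnorm_eq_0_iff:
  assumes "countably_complete F" "ess_bdd F f"
  shows "supnorm F f = 0 \<longleftrightarrow> (\<forall>\<^sub>F x in F. f x = 0)"
proof
  assume "supnorm F f = 0"
  then show "\<forall>\<^sub>F x in F. f x = 0" using eventually_le_supnorm[OF assms] by simp
next
  assume "\<forall>\<^sub>F x in F. f x = 0"
  then have "supnorm F f \<le> 0" by (intro supnorm_le) (auto elim: eventually_mono)
  then show "supnorm F f = 0" using supnorm_nonneg[OF assms(2)] by simp
qed

text \<open>The common ground of the two kinds of spaces: a complex vector space of functions with a
  seminorm whose kernel consists of the negligible functions. \<open>complete\<close> refers to the
  filter, not to the norm. Closure under real parts provides the real functions on which positivity
  of an operator can be tested.\<close>

locale function_space =
  fixes E :: "'a fspace"
  assumes complete: "countably_complete (ae E)"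
    and add: "\<And>f g. f \<in> Fun E \<Longrightarrow> g \<in> Fun E \<Longrightarrow> (\<lambda>x. f x + g x) \<in> Fun E"
    and scale: "\<And>f c. f \<in> Fun E \<Longrightarrow> (\<lambda>x. c * f x) \<in> Fun E"
    and Re: "\<And>f. f \<in> Fun E \<Longrightarrow> (\<lambda>x. of_real (Re (f x))) \<in> Fun E"
    and nrm_nonneg: "\<And>f. f \<in> Fun E \<Longrightarrow> 0 \<le> nrm E f"
    and nrm_add: "\<And>f g. f \<in> Fun E \<Longrightarrow> g \<in> Fun E \<Longrightarrow> nrm E (\<lambda>x. f x + g x) \<le> nrm E f + nrm E g"
    and nrm_scale: "\<And>f c. f \<in> Fun E \<Longrightarrow> nrm E (\<lambda>x. c * f x) \<le> cmod c * nrm E f"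
    and nrm_eq_0_iff: "\<And>f. f \<in> Fun E \<Longrightarrow> nrm E f = 0 \<longleftrightarrow> (\<forall>\<^sub>F x in ae E. f x = 0)"

lemma function_space_Cb: "function_space (Cb_space X)"
proof -
  have bdd: "bounded (f ` topspace X) \<longleftrightarrow> ess_bdd (principal (topspace X)) f" for f :: "'a \<Rightarrow> complex"
    by (auto simp: bounded_iff ess_bdd_def eventually_principal)
  have comp: "continuous_map X euclidean (\<lambda>x. h (f x))"
    if "continuous_map X euclidean f" "continuous_on UNIV h" for f h :: "_ \<Rightarrow> complex"
    using continuous_map_compose[OF that(1), of euclidean h] that(2) by (simp add: o_def)
  have eq: "Cb_space X = \<lparr>Fun = {f. continuous_map X euclidean f \<and> ess_bdd (principal (topspace X)) f},
      ae = principal (topspace X), nrm = supnorm (principal (topspace X))\<rparr>"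
    by (simp add: Cb_space_def bdd)
  show ?thesis
    unfolding eq
  proof (unfold_locales, goal_cases)
    case 1
    then show ?case by (simp add: countably_complete_principal)
  next
    case (2 f g)
    then show ?case by (simp add: continuous_map_add ess_bdd_add)
  next
    case (3 f c)
    have "continuous_on UNIV ((*) c)" by (intro continuous_intros)
    with 3 show ?case by (simp add: comp ess_bdd_mult)
  next
    case (4 f)
    have "continuous_on UNIV (\<lambda>z. complex_of_real (Re z))" by (intro continuous_intros)
    then have "continuous_map X euclidean (\<lambda>x. complex_of_real (Re (f x)))"
      using 4 comp[of f "\<lambda>z. complex_of_real (Re z)"] by simp
    with 4 show ?case by (simp add: ess_bdd_Re)
  next
    case (5 f)
    then show ?case by (simp add: supnorm_nonneg)
  next
    case (6 f g)
    then show ?case by (simp add: countably_complete_principal supnorm_add)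
  next
    case (7 f c)
    then show ?case by (simp add: countably_complete_principal supnorm_mult)
  next
    case (8 f)
    then show ?case by (simp add: countably_complete_principal supnorm_eq_0_iff)
  qed
qed

section \<open>Minkowski's inequality and the spaces L^p\<close>

lemma powr_add_le_weighted:
  fixes x y a b q :: real
  assumes "1 \<le> q" "0 \<le> x" "0 \<le> y" "0 < a" "0 < b"
  shows "(x + y) powr q \<le> (a + b) powr q * (a / (a + b) * (x / a) powr q + b / (a + b) * (y / b) powr q)"
proof -
  \<comment> \<open>(x + y) / (a + b) is the mean of x / a and y / b with weights 1 - s and s; the
    claim is convexity of the q-th power at this mean.\<close>
  define s where "s = b / (a + b)"
  have s: "0 < s" "s < 1" "1 - s = a / (a + b)" using assms by (auto simp: s_def field_simps)
  have conv: "((1 - s) * u + s * v) powr q \<le> (1 - s) * u powr q + s * v powr q"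
    if uv: "0 \<le> u" "0 \<le> v" for u v
  proof -
    \<comment> \<open>Convexity of \<open>powr\<close> is invoked for positive arguments. If u or v
      is 0, the inequality reduces to this estimate for the weight of the other one.\<close>
    have le: "w powr q \<le> w" if "0 < w" "w < 1" for w :: real
      using powr_mono'[of 1 q w] that assms by simp
    consider "u = 0" | "v = 0" | "0 < u" "0 < v" using uv by linarith
    then show ?thesis
    proof cases
      case 1
      then show ?thesis using le[of s] s uv assms by (simp add: powr_mult mult_right_mono)
    next
      case 2
      then show ?thesis using le[of "1 - s"] s(1,2) uv assms by (simp add: powr_mult mult_right_mono)
    next
      case 3
      then show ?thesis using convex_onD[OF powr_convex[OF assms(1)], of s u v] s by simp
    qed
  qed
  have "(x + y) powr q = ((a + b) * ((1 - s) * (x / a) + s * (y / b))) powr q"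
  proof -
    have "(1 - s) * (x / a) = x / (a + b)" "s * (y / b) = y / (a + b)"
      unfolding s(3) using assms by (auto simp: s_def)
    then show ?thesis using assms by (simp flip: add_divide_distrib)
  qed
  also have "\<dots> = (a + b) powr q * ((1 - s) * (x / a) + s * (y / b)) powr q"
    using assms s by (simp add: powr_mult)
  also have "\<dots> \<le> (a + b) powr q * ((1 - s) * (x / a) powr q + s * (y / b) powr q)"
    using assms by (intro mult_left_mono conv) auto
  finally show ?thesis unfolding s(3) by (simp add: s_def)
qed

lemma integrable_powr_add:
  fixes f g :: "'a \<Rightarrow> complex"
  assumes q: "1 \<le> q"
    and [measurable]: "f \<in> borel_measurable M" "g \<in> borel_measurable M"
    and int: "integrable M (\<lambda>x. cmod (f x) powr q)" "integrable M (\<lambda>x. cmod (g x) powr q)"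
  shows "integrable M (\<lambda>x. cmod (f x + g x) powr q)"
proof (rule Bochner_Integration.integrable_bound)
  \<comment> \<open>This majorant is the weighted inequality with a = b = 1.\<close>
  let ?h = "\<lambda>x. 2 powr q * (1 / 2 * cmod (f x) powr q + 1 / 2 * cmod (g x) powr q)"
  show "integrable M ?h" using int by simp
  have "cmod (f x + g x) powr q \<le> ?h x" for x
  proof -
    have "cmod (f x + g x) powr q \<le> (cmod (f x) + cmod (g x)) powr q"
      using q by (intro powr_mono2 norm_triangle_ineq) auto
    also have "\<dots> \<le> ?h x" using powr_add_le_weighted[of q "cmod (f x)" "cmod (g x)" 1 1] q by simp
    finally show ?thesis .
  qed
  then show "AE x in M. norm (cmod (f x + g x) powr q) \<le> norm (?h x)"
    by (intro AE_I2) (smt (verit) real_norm_def powr_ge_zero)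
qed simp

text \<open>Integrate \<open>powr_add_le_weighted\<close> with a and b just above the norms of f and
  g: both normalised integrals are at most 1, the weights add up to 1, and (a + b)^q
  remains.\<close>

lemma Minkowski:
  fixes f g :: "'a \<Rightarrow> complex"
  assumes q: "1 \<le> q"
    and meas: "f \<in> borel_measurable M" "g \<in> borel_measurable M"
    and int: "integrable M (\<lambda>x. cmod (f x) powr q)" "integrable M (\<lambda>x. cmod (g x) powr q)"
  shows "(\<integral>x. cmod (f x + g x) powr q \<partial>M) powr (1 / q) \<le>
    (\<integral>x. cmod (f x) powr q \<partial>M) powr (1 / q) + (\<integral>x. cmod (g x) powr q \<partial>M) powr (1 / q)"
    (is "?L \<le> ?F + ?G")
proof (rule field_le_epsilon)
  fix e :: real assume e: "0 < e"
  \<comment> \<open>a and b occur as divisors, and the norms may be 0; the summand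
    \<open>e / 2\<close> keeps both positive.\<close>
  define a b where "a = ?F + e / 2" and "b = ?G + e / 2"
  have ab: "0 < a" "0 < b" using e by (auto simp: a_def b_def add_nonneg_pos)
  have le1: "(\<integral>x. cmod (h x) powr q \<partial>M) / c powr q \<le> 1"
    if "(\<integral>x. cmod (h x) powr q \<partial>M) powr (1 / q) + e / 2 = c" for h :: "'a \<Rightarrow> complex" and c
  proof -
    have "(\<integral>x. cmod (h x) powr q \<partial>M) = ((\<integral>x. cmod (h x) powr q \<partial>M) powr (1 / q)) powr q"
      using q by (simp add: powr_powr)
    also have "\<dots> \<le> c powr q" using q e that by (intro powr_mono2) auto
    finally show ?thesis by (simp add: divide_le_eq_1)
  qed
  have "(\<integral>x. cmod (f x + g x) powr q \<partial>M) \<le>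
      (\<integral>x. (a + b) powr q * (a / (a + b) * (cmod (f x) powr q / a powr q) +
        b / (a + b) * (cmod (g x) powr q / b powr q)) \<partial>M)"
  proof (rule integral_mono)
    fix x
    have "cmod (f x + g x) powr q \<le> (cmod (f x) + cmod (g x)) powr q"
      using q by (intro powr_mono2 norm_triangle_ineq) auto
    also have "\<dots> \<le> (a + b) powr q * (a / (a + b) * (cmod (f x) / a) powr q + b / (a + b) * (cmod (g x) / b) powr q)"
      using ab q by (intro powr_add_le_weighted) auto
    finally show "cmod (f x + g x) powr q \<le> (a + b) powr q * (a / (a + b) * (cmod (f x) powr q / a powr q) +
        b / (a + b) * (cmod (g x) powr q / b powr q))"
      using ab by (simp add: powr_divide)
  qed (use int integrable_powr_add[OF q meas int] in auto)
  also have "\<dots> = (a + b) powr q * (a / (a + b) * ((\<integral>x. cmod (f x) powr q \<partial>M) / a powr q) +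
        b / (a + b) * ((\<integral>x. cmod (g x) powr q \<partial>M) / b powr q))"
    using int by simp
  also have "\<dots> \<le> (a + b) powr q * (a / (a + b) * 1 + b / (a + b) * 1)"
    using ab le1[of f a] le1[of g b]
    by (intro mult_left_mono add_mono) (auto simp: a_def b_def)
  also have "\<dots> = (a + b) powr q" using ab by (simp flip: add_divide_distrib)
  finally have "?L \<le> ((a + b) powr q) powr (1 / q)" using q by (intro powr_mono2) auto
  also have "\<dots> = ?F + ?G + e" using q ab by (simp add: powr_powr a_def b_def)
  finally show "?L \<le> ?F + ?G + e" .
qed

lemma function_space_Lp:
  fixes M :: "'a measure"
  assumes "1 \<le> p"
  shows "function_space (Lp_space p M)"
proof (cases "p = \<infinity>")
  case True
  have eq: "Lp_space p M = \<lparr>Fun = {f \<in> borel_measurable M. ess_bdd (ae_filter M) f},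
      ae = ae_filter M, nrm = supnorm (ae_filter M)\<rparr>"
    by (simp add: Lp_space_def True)
  show ?thesis
    unfolding eq
  proof (unfold_locales, goal_cases)
    case 1
    then show ?case by (simp add: countably_complete_ae_filter)
  next
    case (2 f g)
    then show ?case by (simp add: borel_measurable_add ess_bdd_add)
  next
    case (3 f c)
    then have [measurable]: "f \<in> borel_measurable M" by simp
    show ?case using 3 by (simp add: ess_bdd_mult)
  next
    case (4 f)
    then have [measurable]: "f \<in> borel_measurable M" by simp
    show ?case using 4 by (simp add: ess_bdd_Re)
  next
    case (5 f)
    then show ?case by (simp add: supnorm_nonneg)
  next
    case (6 f g)
    then show ?case by (simp add: countably_complete_ae_filter supnorm_add)
  next
    case (7 f c)
    then show ?case by (simp add: countably_complete_ae_filter supnorm_mult)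
  next
    case (8 f)
    then show ?case by (simp add: countably_complete_ae_filter supnorm_eq_0_iff)
  qed
next
  case False
  define q where "q = enn2real p"
  have q: "1 \<le> q"
    using assms False enn2real_mono[of 1 p] by (simp add: q_def less_top)
  have eq: "Lp_space p M = \<lparr>Fun = {f \<in> borel_measurable M. integrable M (\<lambda>x. cmod (f x) powr q)},
      ae = ae_filter M, nrm = (\<lambda>f. (\<integral>x. cmod (f x) powr q \<partial>M) powr (1 / q))\<rparr>"
    using False by (simp add: Lp_space_def q_def)
  show ?thesis
    unfolding eq
  proof (unfold_locales, goal_cases)
    case 1
    then show ?case by (simp add: countably_complete_ae_filter)
  next
    case (2 f g)
    then show ?case by (auto intro: integrable_powr_add[OF q])
  next
    case (3 f c)
    then have [measurable]: "f \<in> borel_measurable M" by simp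
    show ?case using 3 by (simp add: norm_mult powr_mult)
  next
    case (4 f)
    then have [measurable]: "f \<in> borel_measurable M" and f: "integrable M (\<lambda>x. cmod (f x) powr q)"
      by auto
    have "integrable M (\<lambda>x. \<bar>Re (f x)\<bar> powr q)"
    proof (rule Bochner_Integration.integrable_bound[OF f])
      show "AE x in M. norm (\<bar>Re (f x)\<bar> powr q) \<le> norm (cmod (f x) powr q)"
        using q by (intro AE_I2) (simp add: powr_mono2 abs_Re_le_cmod)
    qed simp
    then show ?case by simp
  next
    case (5 f)
    then show ?case by simp
  next
    case (6 f g)
    then show ?case by (auto intro: Minkowski[OF q])
  next
    case (7 f c)
    then show ?case using q by (simp add: norm_mult powr_mult powr_powr)
  next
    case (8 f)
    then show ?case by (simp add: integral_nonneg_eq_0_iff_AE)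
  qed
qed

lemma function_space_Cb_or_Lp:
  assumes "Cb_or_Lp E"
  shows "function_space E"
  using assms function_space_Cb function_space_Lp by (auto simp: Cb_or_Lp_def)

section \<open>Norms and linear operators modulo eventual equality\<close>

context function_space
begin

lemma diff:
  assumes "f \<in> Fun E" "g \<in> Fun E"
  shows "(\<lambda>x. f x - g x) \<in> Fun E"
  using add[OF assms(1) scale[OF assms(2), of "-1"]] by simp

text \<open>The difference of the two functions has norm 0, so the triangle inequality bounds either
  norm by the other.\<close>

lemma nrm_cong:
  assumes f: "f \<in> Fun E" and g: "g \<in> Fun E" and "eqv E f g"
  shows "nrm E f = nrm E g"
proof -
  have le: "nrm E f \<le> nrm E g" if "f \<in> Fun E" "g \<in> Fun E" "eqv E f g" for f g
  proof -
    have "nrm E (\<lambda>x. f x - g x) = 0"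
      using that diff nrm_eq_0_iff by (simp add: eqv_def)
    then show ?thesis using nrm_add[OF that(2) diff[OF that(1,2)]] by simp
  qed
  have "eqv E g f" using assms(3) by (simp add: eqv_def eq_commute)
  then show ?thesis using le assms by (intro antisym)
qed

lemma nrm_diff_eq_0_iff:
  assumes "f \<in> Fun E" "g \<in> Fun E"
  shows "nrm E (\<lambda>x. f x - g x) = 0 \<longleftrightarrow> eqv E f g"
  using nrm_eq_0_iff[OF diff[OF assms]] by (simp add: eqv_def)

lemma nrm_diff_commute:
  assumes "f \<in> Fun E" "g \<in> Fun E"
  shows "nrm E (\<lambda>x. f x - g x) = nrm E (\<lambda>x. g x - f x)"
proof -
  have "nrm E (\<lambda>x. f x - g x) \<le> nrm E (\<lambda>x. g x - f x)" if "f \<in> Fun E" "g \<in> Fun E" for f g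
    using nrm_scale[OF diff[OF that(2,1)], of "-1"] by simp
  then show ?thesis using assms by (intro antisym)
qed

lemma nrm_diff_triangle:
  assumes "f \<in> Fun E" "g \<in> Fun E" "h \<in> Fun E"
  shows "nrm E (\<lambda>x. f x - h x) \<le> nrm E (\<lambda>x. f x - g x) + nrm E (\<lambda>x. g x - h x)"
  using nrm_add[OF diff[OF assms(1,2)] diff[OF assms(2,3)]] by simp

end

lemma eqv_refl: "eqv E f f"
  by (simp add: eqv_def)

lemma eqv_sym: "eqv E f g \<Longrightarrow> eqv E g f"
  by (simp add: eqv_def eq_commute)

lemma eqv_trans [trans]: "eqv E f g \<Longrightarrow> eqv E g h \<Longrightarrow> eqv E f h"
  unfolding eqv_def by (erule (1) eventually_elim2) simp

lemma eqv_mult: "eqv E f g \<Longrightarrow> eqv E (\<lambda>x. c * f x) (\<lambda>x. c * g x)"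
  unfolding eqv_def by (erule eventually_mono) simp

lemma linear_op_mem: "linear_op E D A \<Longrightarrow> f \<in> D \<Longrightarrow> A f \<in> Fun E"
  unfolding linear_op_def by blast

lemma linear_op_cong:
  "linear_op E D A \<Longrightarrow> f \<in> D \<Longrightarrow> g \<in> D \<Longrightarrow> eqv E f g \<Longrightarrow> eqv E (A f) (A g)"
  unfolding linear_op_def by blast

lemma linear_op_add:
  "linear_op E D A \<Longrightarrow> f \<in> D \<Longrightarrow> g \<in> D \<Longrightarrow> eqv E (A (\<lambda>x. f x + g x)) (\<lambda>x. A f x + A g x)"
  unfolding linear_op_def by blast

lemma linear_op_scale:
  "linear_op E D A \<Longrightarrow> f \<in> D \<Longrightarrow> eqv E (A (\<lambda>x. c * f x)) (\<lambda>x. c * A f x)"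
  unfolding linear_op_def by blast

lemma linear_op_diff:
  assumes A: "linear_op E D A" and f: "f \<in> D" and g: "g \<in> D"
  shows "eqv E (A (\<lambda>x. f x - g x)) (\<lambda>x. A f x - A g x)"
proof -
  have "(\<lambda>x. - 1 * g x) \<in> D" using A g unfolding linear_op_def by blast
  from linear_op_add[OF A f this] linear_op_scale[OF A g, of "-1"]
  show ?thesis unfolding eqv_def by eventually_elim simp
qed

section \<open>Positive operators and eigenfunctions\<close>

text \<open>The inequality is a closed condition on w and so extends from W to all scalars; the
  choice w = \<open>cnj z\<close> then gives |z|^2 \<le> |z| r.\<close>

lemma cmod_le_dense:
  assumes dense: "closure W = UNIV" and le: "\<And>w. w \<in> W \<Longrightarrow> Re (w * z) \<le> cmod w * r"
  shows "cmod z \<le> r"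
proof -
  have "closed {w. Re (w * z) \<le> cmod w * r}"
    by (intro closed_Collect_le continuous_intros)
  then have "closure W \<subseteq> {w. Re (w * z) \<le> cmod w * r}"
    using le by (intro closure_minimal) auto
  then have all: "Re (w * z) \<le> cmod w * r" for w using dense by auto
  show ?thesis
  proof (cases "z = 0")
    case True
    \<comment> \<open>Here \<open>cnj z\<close> carries no information; w = 1 yields 0 \<le>
      r.\<close>
    then show ?thesis using all[of 1] by simp
  next
    case False
    have "cmod z * cmod z \<le> cmod z * r"
      using all[of "cnj z"] by (simp add: cmod_power2 flip: power2_eq_square)
    then show ?thesis using False by simp
  qed
qed

lemma complex_le_realD:
  fixes z w :: complex
  assumes "z \<le> w"
  shows "Re z \<le> Re w" "Im z = Im w"
  using assms by (auto simp: less_eq_complex_def)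

text \<open>\<open>\<bar>f\<bar> \<le> g\<close> means that \<open>Re (w f) \<le> \<bar>w\<bar> g\<close> for all \<open>w\<close> in a countable dense set of scalars, and
  countably many eventual inequalities can be combined.\<close>

lemma (in function_space) positive_op_dominated:
  assumes B: "positive_op E B" and f: "f \<in> Fun E" and g: "g \<in> Fun E"
    and le: "\<forall>\<^sub>F x in ae E. of_real (cmod (f x)) \<le> g x"
  shows "\<forall>\<^sub>F x in ae E. of_real (cmod (B f x)) \<le> B g x"
proof -
  have lin: "linear_op E (Fun E) B"
    and pos: "\<And>f. f \<in> Fun E \<Longrightarrow> \<forall>\<^sub>F x in ae E. 0 \<le> f x \<Longrightarrow> \<forall>\<^sub>F x in ae E. 0 \<le> B f x"
    using B by (auto simp: positive_op_def bounded_op_def)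
  define u where "u w = (\<lambda>x. complex_of_real (Re (w * f x)))" for w
  have u: "u w \<in> Fun E" for w
    unfolding u_def by (intro Re scale f)
  have u_le: "\<forall>\<^sub>F x in ae E. B (u w) x \<le> of_real (cmod w) * B g x" for w
  proof -
    let ?h = "\<lambda>x. of_real (cmod w) * g x - u w x"
    have "\<forall>\<^sub>F x in ae E. 0 \<le> ?h x"
      using le
    proof eventually_elim
      case (elim x)
      have "Re (w * f x) \<le> cmod w * cmod (f x)"
        using complex_Re_le_cmod[of "w * f x"] by (simp add: norm_mult)
      also have "\<dots> \<le> cmod w * Re (g x)"
        using complex_le_realD(1)[OF elim] by (intro mult_left_mono) auto
      finally show ?case
        using complex_le_realD(2)[OF elim] by (simp add: less_eq_complex_def u_def)
    qed
    then have "\<forall>\<^sub>F x in ae E. 0 \<le> B ?h x" by (intro pos diff scale g u)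
    moreover have "eqv E (B ?h) (\<lambda>x. B (\<lambda>x. of_real (cmod w) * g x) x - B (u w) x)"
      by (intro linear_op_diff[OF lin] scale g u)
    moreover have "eqv E (B (\<lambda>x. of_real (cmod w) * g x)) (\<lambda>x. of_real (cmod w) * B g x)"
      by (intro linear_op_scale[OF lin] g)
    ultimately show ?thesis unfolding eqv_def by eventually_elim simp
  qed
  have "\<forall>\<^sub>F x in ae E. 0 \<le> g x"
    using le
  proof eventually_elim
    case (elim x)
    have "0 \<le> complex_of_real (cmod (f x))" by (simp add: less_eq_complex_def)
    then show ?case using elim by (rule order_trans)
  qed
  then have Bg: "\<forall>\<^sub>F x in ae E. 0 \<le> B g x" by (rule pos[OF g])
  have Re_le: "\<forall>\<^sub>F x in ae E. Re (w * B f x) \<le> cmod w * Re (B g x)" for w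
  proof -
    \<comment> \<open>The imaginary part of w f is the real part of - \<i> w f, so both parts of w f
      belong to the family \<open>u\<close>.\<close>
    have eq: "(\<lambda>x. w * f x) = (\<lambda>x. u w x + \<i> * u (- \<i> * w) x)"
      by (auto simp: u_def complex_eq_iff)
    have "eqv E (B (\<lambda>x. w * f x)) (\<lambda>x. B (u w) x + B (\<lambda>x. \<i> * u (- \<i> * w) x) x)"
      unfolding eq by (intro linear_op_add[OF lin] scale u)
    moreover have "eqv E (B (\<lambda>x. w * f x)) (\<lambda>x. w * B f x)"
      by (intro linear_op_scale[OF lin] f)
    moreover have "eqv E (B (\<lambda>x. \<i> * u (- \<i> * w) x)) (\<lambda>x. \<i> * B (u (- \<i> * w)) x)"
      by (intro linear_op_scale[OF lin] u)
    ultimately show ?thesis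
      using u_le[of w] u_le[of "- \<i> * w"] Bg unfolding eqv_def
    proof eventually_elim
      case (elim x)
      have "w * B f x = B (u w) x + \<i> * B (u (- \<i> * w)) x" using elim(1-3) by simp
      \<comment> \<open>The complex order includes equality of imaginary parts. Since
        \<open>B g x\<close> is real, \<open>u_le\<close> forces both values of B on the family
        \<open>u\<close> to be real, and the term with the factor \<i> drops out of the real
        part.\<close>
      moreover have "Im (B (u (- \<i> * w)) x) = 0" "Re (B (u w) x) \<le> cmod w * Re (B g x)"
        using complex_le_realD[OF elim(4)] complex_le_realD[OF elim(5)] complex_le_realD[OF elim(6)]
        by simp_all
      ultimately show ?case by simp
    qed
  qed
  obtain W :: "complex set" where W: "countable W"
    "\<And>X. open X \<Longrightarrow> X \<noteq> {} \<Longrightarrow> \<exists>w\<in>W. w \<in> X"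
    by (rule countable_dense_setE) blast
  have dense: "closure W = UNIV"
    using W(2)[of "- closure W"] closure_subset by blast
  \<comment> \<open>The exceptional set in \<open>Re_le\<close> depends on w; enumerating the
    countable set W gives one that serves all its elements.\<close>
  have "\<forall>\<^sub>F x in ae E. \<forall>n. Re (from_nat_into W n * B f x) \<le> cmod (from_nat_into W n) * Re (B g x)"
    using complete Re_le by (rule countably_completeD)
  then show ?thesis
    using Bg
  proof eventually_elim
    case (elim x)
    have "cmod (B f x) \<le> Re (B g x)"
    proof (rule cmod_le_dense[OF dense])
      fix w assume "w \<in> W"
      then show "Re (w * B f x) \<le> cmod w * Re (B g x)"
        using elim(1) from_nat_into_surj[OF W(1)] by metis
    qed
    then show ?case using elim(2) by (simp add: less_eq_complex_def)
  qed
qed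

lemma (in function_space) positive_op_dominated_scaled:
  assumes B: "positive_op E B" and f: "f \<in> Fun E" and g: "g \<in> Fun E"
    and le: "\<forall>\<^sub>F x in ae E. of_real (cmod (f x)) \<le> of_real c * g x"
  shows "\<forall>\<^sub>F x in ae E. of_real (cmod (B f x)) \<le> of_real c * B g x"
proof -
  have "linear_op E (Fun E) B" using B by (simp add: positive_op_def bounded_op_def)
  then have "eqv E (B (\<lambda>x. of_real c * g x)) (\<lambda>x. of_real c * B g x)"
    using g by (rule linear_op_scale)
  moreover have "\<forall>\<^sub>F x in ae E. of_real (cmod (B f x)) \<le> B (\<lambda>x. of_real c * g x) x"
    by (intro positive_op_dominated[OF B] f scale g le)
  ultimately show ?thesis unfolding eqv_def by eventually_elim simp
qed

text \<open>\<open>has_positive_inverse\<close> states that B is a right inverse; injectivity of A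
  makes it a left inverse at \<phi>. Applying B to the eigenvalue equation then gives the
  claim.\<close>

lemma (in function_space) eigenfunction_inverse:
  assumes A: "linear_op E D A" and eig: "eigenpair E D A \<mu> \<phi>"
    and inv: "has_positive_inverse E D A B"
  shows "eqv E \<phi> (\<lambda>x. \<mu> * B \<phi> x)"
proof -
  have \<phi>: "\<phi> \<in> D" "eqv E (A \<phi>) (\<lambda>x. \<mu> * \<phi> x)" using eig by (auto simp: eigenpair_def)
  have mem: "\<phi> \<in> Fun E" "A \<phi> \<in> Fun E" using A \<phi> by (auto simp: linear_op_def)
  have lin: "linear_op E (Fun E) B"
    using inv by (simp add: has_positive_inverse_def positive_op_def bounded_op_def)
  have "B (A \<phi>) \<in> D" "eqv E (A (B (A \<phi>))) (A \<phi>)"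
    using inv mem by (auto simp: has_positive_inverse_def)
  then have "eqv E (B (A \<phi>)) \<phi>"
    using inv \<phi> by (auto simp: has_positive_inverse_def bijective_op_def)
  then have "eqv E \<phi> (B (A \<phi>))" by (rule eqv_sym)
  also have "eqv E (B (A \<phi>)) (B (\<lambda>x. \<mu> * \<phi> x))"
    using \<phi> mem by (intro linear_op_cong[OF lin] scale)
  also have "eqv E (B (\<lambda>x. \<mu> * \<phi> x)) (\<lambda>x. \<mu> * B \<phi> x)"
    using mem by (intro linear_op_scale[OF lin])
  finally show ?thesis .
qed

section \<open>The eigenvalue equation for the semigroup\<close>

lemma exp_difference_quotient:
  "((\<lambda>h. (exp (\<mu> * of_real h) - 1) / of_real h) \<longlongrightarrow> \<mu>) (at_right (0::real))" for \<mu> :: complex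
proof -
  have "((\<lambda>z. exp (\<mu> * z)) has_field_derivative \<mu>) (at 0)"
    by (auto intro!: derivative_eq_intros)
  then have "((\<lambda>z. (exp (\<mu> * z) - 1) / z) \<longlongrightarrow> \<mu>) (at 0)"
    by (simp add: has_field_derivative_iff)
  moreover have "filterlim (complex_of_real) (at 0) (at_right 0)"
    unfolding filterlim_at
    by (auto intro!: tendsto_eq_intros simp: eventually_at_right_less eventually_at_filter)
  ultimately show ?thesis by (rule filterlim_compose)
qed

text \<open>The rescaled maps \<open>S s\<close> again form a semigroup. By the product rule the
  right derivative of its orbit through \<phi> at 0 is \<mu> \<phi> - \<mu> \<phi> = 0, so the fixed
  point lemma applies to the pseudometric given by the norm of the difference.\<close>

lemma (in function_space) eigenfunction_semigroup:
  assumes T: "C0_semigroup E T" and \<phi>: "\<phi> \<in> Fun E"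
    and gen: "((\<lambda>h. nrm E (\<lambda>x. (T h \<phi> x - \<phi> x) / of_real h - (- (\<mu> * \<phi> x)))) \<longlongrightarrow> 0) (at_right 0)"
    and t: "0 \<le> t"
  shows "eqv E \<phi> (\<lambda>x. exp (\<mu> * of_real t) * T t \<phi> x)"
proof (cases "t = 0")
  case True
  then show ?thesis using T \<phi> by (auto simp: C0_semigroup_def intro: eqv_sym)
next
  case False
  have bd: "bounded_op E (T s)" if "0 \<le> s" for s using T that by (simp add: C0_semigroup_def)
  then have lin: "linear_op E (Fun E) (T s)" if "0 \<le> s" for s using that by (simp add: bounded_op_def)
  have memT: "T s f \<in> Fun E" if "0 \<le> s" "f \<in> Fun E" for s f
    using lin that by (intro linear_op_mem)
  define e where "e s = exp (\<mu> * complex_of_real s)" for s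
  have e_add: "e (r + s) = e r * e s" for r s
    by (simp add: e_def algebra_simps exp_add)
  have e1: "(e \<longlongrightarrow> 1) (at_right 0)"
    unfolding e_def by (auto intro!: tendsto_eq_intros)
  define S where "S s f = (\<lambda>x. e s * T s f x)" for s f
  define d where "d f g = nrm E (\<lambda>x. f x - g x)" for f g
  have memS: "S s f \<in> Fun E" if "0 \<le> s" "f \<in> Fun E" for s f
    unfolding S_def using that by (intro scale memT)
  have "d (S t \<phi>) \<phi> = 0"
  proof (rule lipschitz_semigroup_fixpoint[where V = "Fun E"])
    show "d f f = 0" if "f \<in> Fun E" for f
      unfolding d_def using that by (intro nrm_diff_eq_0_iff[THEN iffD2] eqv_refl)
    show "0 \<le> d f g" if "f \<in> Fun E" "g \<in> Fun E" for f g
      unfolding d_def using that by (intro nrm_nonneg diff)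
    show "d f g = d g f" if "f \<in> Fun E" "g \<in> Fun E" for f g
      unfolding d_def using that by (rule nrm_diff_commute)
    show "d f h \<le> d f g + d g h" if "f \<in> Fun E" "g \<in> Fun E" "h \<in> Fun E" for f g h
      unfolding d_def using that by (rule nrm_diff_triangle)
    show "S s f \<in> Fun E" if "0 \<le> s" "f \<in> Fun E" for s f
      using that by (rule memS)
    show "\<exists>C. \<forall>f\<in>Fun E. \<forall>g\<in>Fun E. d (S s f) (S s g) \<le> C * d f g" if s: "0 \<le> s" for s
    proof -
      obtain C where C: "\<And>f. f \<in> Fun E \<Longrightarrow> nrm E (T s f) \<le> C * nrm E f"
        using bd[OF s] by (auto simp: bounded_op_def)
      have "d (S s f) (S s g) \<le> (cmod (e s) * C) * d f g" if f: "f \<in> Fun E" and g: "g \<in> Fun E" for f g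
      proof -
        have "d (S s f) (S s g) = nrm E (\<lambda>x. e s * (T s f x - T s g x))"
          by (simp add: d_def S_def algebra_simps)
        also have "\<dots> \<le> cmod (e s) * nrm E (\<lambda>x. T s f x - T s g x)"
          using s f g by (intro nrm_scale diff memT)
        also have "nrm E (\<lambda>x. T s f x - T s g x) = nrm E (T s (\<lambda>x. f x - g x))"
          using s f g by (intro nrm_cong diff memT eqv_sym[OF linear_op_diff[OF lin]])
        also have "cmod (e s) * \<dots> \<le> cmod (e s) * (C * d f g)"
          unfolding d_def using f g by (intro mult_left_mono C diff) auto
        finally show ?thesis by (simp add: mult.assoc)
      qed
      then show ?thesis by blast
    qed
    show "d (S (r + s) f) (S r (S s f)) = 0" if r: "0 \<le> r" and s: "0 \<le> s" and f: "f \<in> Fun E" for r s f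
    proof -
      have "eqv E (T (r + s) f) (T r (T s f))"
        using T r s f by (simp add: C0_semigroup_def)
      moreover have "eqv E (T r (S s f)) (\<lambda>x. e s * T r (T s f) x)"
        unfolding S_def using r s f by (intro linear_op_scale[OF lin] memT)
      ultimately have "eqv E (S (r + s) f) (S r (S s f))"
        unfolding eqv_def S_def[of "r + s"] S_def[of r] by eventually_elim (simp add: e_add)
      then show ?thesis unfolding d_def using r s f by (simp add: nrm_diff_eq_0_iff memS)
    qed
    show "((\<lambda>h. d (S h f) f) \<longlongrightarrow> 0) (at_right 0)" if f: "f \<in> Fun E" for f
    proof (rule tendsto_sandwich[OF _ _ tendsto_const])
      \<comment> \<open>Bound obtained from the splitting of \<open>S h f - f\<close> into
        \<open>e h * (T h f - f)\<close> and \<open>(e h - 1) * f\<close>.\<close>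
      let ?b = "\<lambda>h. cmod (e h) * nrm E (\<lambda>x. T h f x - f x) + cmod (e h - 1) * nrm E f"
      show "\<forall>\<^sub>F h in at_right 0. 0 \<le> d (S h f) f"
        using eventually_at_right_less
        by (rule eventually_mono) (auto simp: d_def intro!: nrm_nonneg diff memS f)
      show "\<forall>\<^sub>F h in at_right 0. d (S h f) f \<le> ?b h"
        using eventually_at_right_less
      proof (rule eventually_mono)
        fix h :: real assume h: "0 < h"
        have "d (S h f) f = nrm E (\<lambda>x. e h * (T h f x - f x) + (e h - 1) * f x)"
          by (simp add: d_def S_def algebra_simps)
        also have "\<dots> \<le> nrm E (\<lambda>x. e h * (T h f x - f x)) + nrm E (\<lambda>x. (e h - 1) * f x)"
          using h by (intro nrm_add scale diff memT f) auto
        also have "\<dots> \<le> ?b h"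
          using h by (intro add_mono nrm_scale diff memT f) auto
        finally show "d (S h f) f \<le> ?b h" .
      qed
      have "((\<lambda>h. nrm E (\<lambda>x. T h f x - f x)) \<longlongrightarrow> 0) (at_right 0)"
        using T f by (simp add: C0_semigroup_def)
      then show "(?b \<longlongrightarrow> 0) (at_right 0)"
        using e1 by (auto intro!: tendsto_eq_intros)
    qed
    show "((\<lambda>h. d (S h \<phi>) \<phi> / h) \<longlongrightarrow> 0) (at_right 0)"
    proof (rule tendsto_sandwich[OF _ _ tendsto_const])
      let ?q = "\<lambda>h x. (T h \<phi> x - \<phi> x) / complex_of_real h - (- (\<mu> * \<phi> x))"
      \<comment> \<open>Product rule with remainder: \<open>(S h \<phi> - \<phi>) / h\<close> equals
        \<open>e h * ?q h + ?c h * \<phi>\<close>. The norm of \<open>?q h\<close> tends to 0 by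
        \<open>gen\<close>, and \<open>?c h\<close> tends to \<mu> - \<mu> = 0.\<close>
      let ?c = "\<lambda>h. (e h - 1) / complex_of_real h - \<mu> * e h"
      let ?b = "\<lambda>h. cmod (e h) * nrm E (?q h) + cmod (?c h) * nrm E \<phi>"
      show "\<forall>\<^sub>F h in at_right 0. 0 \<le> d (S h \<phi>) \<phi> / h"
        using eventually_at_right_less
        by (rule eventually_mono) (auto simp: d_def intro!: divide_nonneg_pos nrm_nonneg diff memS \<phi>)
      show "\<forall>\<^sub>F h in at_right 0. d (S h \<phi>) \<phi> / h \<le> ?b h"
        using eventually_at_right_less
      proof (rule eventually_mono)
        fix h :: real assume h: "0 < h"
        have "(\<lambda>x. 1 / complex_of_real h * (T h \<phi> x - \<phi> x) - (- \<mu>) * \<phi> x) \<in> Fun E"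
          using h by (intro diff scale memT \<phi>) auto
        then have q: "?q h \<in> Fun E" by simp
        have "S h \<phi> x - \<phi> x = of_real h * (e h * ?q h x + ?c h * \<phi> x)" for x
          using h by (simp add: S_def field_simps)
        then have "d (S h \<phi>) \<phi> = nrm E (\<lambda>x. of_real h * (e h * ?q h x + ?c h * \<phi> x))"
          by (simp only: d_def)
        also have "\<dots> \<le> cmod (of_real h) * nrm E (\<lambda>x. e h * ?q h x + ?c h * \<phi> x)"
          by (intro nrm_scale add scale q \<phi>)
        also have "\<dots> \<le> cmod (of_real h) * (nrm E (\<lambda>x. e h * ?q h x) + nrm E (\<lambda>x. ?c h * \<phi> x))"
          by (intro mult_left_mono nrm_add scale q \<phi>) auto
        also have "\<dots> \<le> cmod (of_real h) * ?b h"
          by (intro mult_left_mono add_mono nrm_scale q \<phi>) auto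
        finally show "d (S h \<phi>) \<phi> / h \<le> ?b h"
          using h by (simp add: divide_le_eq mult.commute)
      qed
      have "(?c \<longlongrightarrow> \<mu> - \<mu> * 1) (at_right 0)"
        using exp_difference_quotient[of \<mu>] e1 unfolding e_def
        by (intro tendsto_diff tendsto_mult tendsto_const)
      then have c: "((\<lambda>h. cmod (?c h)) \<longlongrightarrow> 0) (at_right 0)"
        by (intro tendsto_norm_zero) simp
      have "(?b \<longlongrightarrow> cmod 1 * 0 + 0 * nrm E \<phi>) (at_right 0)"
        by (rule tendsto_add[OF tendsto_mult[OF tendsto_norm[OF e1] gen] tendsto_mult[OF c tendsto_const]])
      then show "(?b \<longlongrightarrow> 0) (at_right 0)" by simp
    qed
  qed (use \<phi> t False in auto)
  then have "eqv E (S t \<phi>) \<phi>"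
    unfolding d_def using t \<phi> by (simp add: nrm_diff_eq_0_iff memS)
  then show ?thesis unfolding S_def e_def by (rule eqv_sym)
qed

text \<open>The modulus of \<phi> is exp(t Re \<mu>) times that of \<open>T t \<phi>\<close>, and
  \<open>T t\<close> preserves the domination by c g. The majorant is left general because it is
  \<rho> in one application and the image of \<rho> under the inverse in the other.\<close>

lemma (in function_space) eigenfunction_semigroup_bound:
  assumes A: "linear_op E D A" and eig: "eigenpair E D A \<mu> \<phi>"
    and T: "generates_positive_semigroup E D (\<lambda>f x. - A f x) T" and t: "0 \<le> t"
    and g: "g \<in> Fun E" and le: "\<forall>\<^sub>F x in ae E. of_real (cmod (\<phi> x)) \<le> of_real c * g x"
  shows "\<forall>\<^sub>F x in ae E. of_real (cmod (\<phi> x)) \<le> of_real (c * exp (t * Re \<mu>)) * T t g x"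
proof -
  have \<phi>: "\<phi> \<in> D" "eqv E (A \<phi>) (\<lambda>x. \<mu> * \<phi> x)" using eig by (auto simp: eigenpair_def)
  have mem: "\<phi> \<in> Fun E" "(\<lambda>x. - (\<mu> * \<phi> x)) \<in> Fun E"
    using A \<phi> scale[of \<phi> "- \<mu>"] by (auto simp: linear_op_def)
  have gen: "generates E D (\<lambda>f x. - A f x) T" and pos: "positive_op E (T t)"
    using T t by (auto simp: generates_positive_semigroup_def)
  have "eqv E (\<lambda>x. - A \<phi> x) (\<lambda>x. - (\<mu> * \<phi> x))" using eqv_mult[OF \<phi>(2), of "-1"] by simp
  \<comment> \<open>The graph description of the generator, read from left to right for the pair
    (\<phi>, - \<mu> \<phi>).\<close>
  with \<phi>(1) have "((\<lambda>h. nrm E (\<lambda>x. (T h \<phi> x - \<phi> x) / of_real h - (- (\<mu> * \<phi> x)))) \<longlongrightarrow> 0) (at_right 0)"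
    using gen[unfolded generates_def, THEN conjunct2, THEN conjunct2, rule_format, OF mem] by simp
  moreover have "C0_semigroup E T" using gen by (simp add: generates_def)
  ultimately have "eqv E \<phi> (\<lambda>x. exp (\<mu> * of_real t) * T t \<phi> x)"
    using mem t by (intro eigenfunction_semigroup)
  moreover have "\<forall>\<^sub>F x in ae E. of_real (cmod (T t \<phi> x)) \<le> of_real c * T t g x"
    using pos mem(1) g le by (rule positive_op_dominated_scaled)
  ultimately show ?thesis
    unfolding eqv_def
  proof eventually_elim
    case (elim x)
    have "cmod (\<phi> x) = exp (t * Re \<mu>) * cmod (T t \<phi> x)"
      by (subst elim(1)) (simp add: norm_mult mult.commute)
    then have "complex_of_real (cmod (\<phi> x)) = of_real (exp (t * Re \<mu>)) * of_real (cmod (T t \<phi> x))"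
      by (simp only: of_real_mult)
    also have "\<dots> \<le> of_real (exp (t * Re \<mu>)) * (of_real c * T t g x)"
      using elim(2) by (intro mult_left_mono) (auto simp: less_eq_complex_def)
    finally show ?case by (simp only: of_real_mult mult_ac)
  qed
qed

theorem proposition6p1:
  fixes E :: "'a fspace"
    and D :: "('a \<Rightarrow> complex) set"
    and A :: "('a \<Rightarrow> complex) \<Rightarrow> 'a \<Rightarrow> complex"
    and \<mu> :: complex
    and \<phi> \<rho> :: "'a \<Rightarrow> complex"
  assumes "Cb_or_Lp E"
    and "closed_op E D A"
    and "eigenpair E D A \<mu> \<phi>"
    and "\<rho> \<in> Fun E"
    and "\<forall>\<^sub>F x in ae E. 0 < \<rho> x"
    and "ess_bdd (ae E) (\<lambda>x. \<phi> x / \<rho> x)"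
  shows
    "(\<forall>Ainv. has_positive_inverse E D A Ainv \<longrightarrow>
        (\<forall>\<^sub>F x in ae E.
          of_real (cmod (\<phi> x))
            \<le> of_real (cmod \<mu> * supnorm (ae E) (\<lambda>x. \<phi> x / \<rho> x)) * Ainv \<rho> x)) \<and>
     (\<forall>T. generates_positive_semigroup E D (\<lambda>f x. - A f x) T \<longrightarrow>
        (\<forall>t\<ge>0. \<forall>\<^sub>F x in ae E.
          of_real (cmod (\<phi> x))
            \<le> of_real (supnorm (ae E) (\<lambda>x. \<phi> x / \<rho> x) * exp (t * Re \<mu>)) * T t \<rho> x)) \<and>
     (\<forall>Ainv T. has_positive_inverse E D A Ainv \<and>
               generates_positive_semigroup E D (\<lambda>f x. - A f x) T \<longrightarrow>
        (\<forall>t\<ge>0. \<forall>\<^sub>F x in ae E.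
          of_real (cmod (\<phi> x))
            \<le> of_real (cmod \<mu> * supnorm (ae E) (\<lambda>x. \<phi> x / \<rho> x) * exp (t * Re \<mu>))
                * T t (Ainv \<rho>) x))"
proof -
  interpret function_space E using assms(1) by (rule function_space_Cb_or_Lp)
  have A: "linear_op E D A" using assms(2) by (simp add: closed_op_def)
  have \<phi>: "\<phi> \<in> Fun E" using A assms(3) by (auto simp: linear_op_def eigenpair_def)
  let ?c = "supnorm (ae E) (\<lambda>x. \<phi> x / \<rho> x)"
  have le: "\<forall>\<^sub>F x in ae E. of_real (cmod (\<phi> x)) \<le> of_real ?c * \<rho> x"
    using eventually_le_supnorm[OF complete assms(6)] assms(5)
  proof eventually_elim
    case (elim x)
    \<comment> \<open>Positivity in the complex order makes \<open>\<rho> x\<close> real, so the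
      bound on the modulus of the quotient can be multiplied out.\<close>
    have \<rho>: "\<rho> x = of_real (Re (\<rho> x))" "0 < Re (\<rho> x)"
      using elim(2) by (auto simp: less_complex_def complex_eq_iff)
    have "cmod (\<rho> x) = Re (\<rho> x)" by (subst \<rho>(1)) (use \<rho>(2) in simp)
    then have "cmod (\<phi> x) \<le> ?c * Re (\<rho> x)"
      using elim(1) \<rho>(2) by (simp add: norm_divide divide_le_eq)
    then show ?case using \<rho> by (simp add: less_eq_complex_def complex_eq_iff)
  qed
  have inverse: "\<forall>\<^sub>F x in ae E. of_real (cmod (\<phi> x)) \<le> of_real (cmod \<mu> * ?c) * B \<rho> x"
    if B: "has_positive_inverse E D A B" for B
  proof -
    have "positive_op E B" using B by (simp add: has_positive_inverse_def)
    then have "\<forall>\<^sub>F x in ae E. of_real (cmod (B \<phi> x)) \<le> of_real ?c * B \<rho> x"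
      using \<phi> assms(4) le by (rule positive_op_dominated_scaled)
    with eigenfunction_inverse[OF A assms(3) B] show ?thesis
      unfolding eqv_def
    proof eventually_elim
      case (elim x)
      have "cmod (\<phi> x) = cmod \<mu> * cmod (B \<phi> x)" by (subst elim(1)) (simp add: norm_mult)
      then have "complex_of_real (cmod (\<phi> x)) = of_real (cmod \<mu>) * of_real (cmod (B \<phi> x))"
        by (simp only: of_real_mult)
      also have "\<dots> \<le> of_real (cmod \<mu>) * (of_real ?c * B \<rho> x)"
        using elim(2) by (intro mult_left_mono) (auto simp: less_eq_complex_def)
      finally show ?case by (simp only: of_real_mult mult_ac)
    qed
  qed
  show ?thesis
  proof (intro conjI allI impI; (elim conjE)?)
    fix T and t :: real
    assume T: "generates_positive_semigroup E D (\<lambda>f x. - A f x) T" and t: "0 \<le> t"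
    show "\<forall>\<^sub>F x in ae E. of_real (cmod (\<phi> x)) \<le> of_real (?c * exp (t * Re \<mu>)) * T t \<rho> x"
      using A assms(3) T t assms(4) le by (rule eigenfunction_semigroup_bound)
    fix B
    assume B: "has_positive_inverse E D A B"
    then have "B \<rho> \<in> Fun E"
      using assms(4)
      by (auto simp: has_positive_inverse_def positive_op_def bounded_op_def linear_op_def)
    \<comment> \<open>\<open>inverse\<close> supplies the domination hypothesis, with
      \<open>B \<rho>\<close> in the place of \<rho> and the constant enlarged by the factor
      |\<mu>|.\<close>
    then show "\<forall>\<^sub>F x in ae E. of_real (cmod (\<phi> x)) \<le>
        of_real (cmod \<mu> * ?c * exp (t * Re \<mu>)) * T t (B \<rho>) x"
      using inverse[OF B] by (rule eigenfunction_semigroup_bound[OF A assms(3) T t])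
  qed (rule inverse)
qed

end
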